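(* Let $0<\alpha\le1$, let $a<b$ be real numbers, and let $f:[a,b]\to\mathbb{R}^\alpha$ with $f\in I_x^{(\alpha)}[a,b]$ be a generalized convex function on $[a,b]$. Then $$f\left(\frac{a+b}{2}\right)\le\frac{\Gamma(1+\alpha)}{(b-a)^\alpha}\;{}_aI_b^{(\alpha)}f(x)\le\frac{f(a)+f(b)}{2^\alpha}.$$
   Context: For $0<\alpha\le1$, $\mathbb{R}^\alpha$ denotes the $\alpha$-type set of real line numbers: its elements are the symbols $a^\alpha$ with $a\in\mathbb{R}$, with operations $a^\alpha+b^\alpha=(a+b)^\alpha$ and $a^\alpha b^\alpha=(ab)^\alpha$. These are commutative and associative, multiplication distributes over addition, $0^\alpha$ is the additive identity and $1^\alpha$ is the multiplicative identity. Order: $a^\alpha\le b^\alpha$ iff $a\le b$. Quotients by $c^\alpha$, $c\ne0$, are taken in $\mathbb{R}^\alpha$, and limits are understood with respect to $|a^\alpha|=|a|^\alpha<\varepsilon^\alpha$. Real constants such as $\Gamma(1+\alpha)$ and $1/\Gamma(1+\alpha)$ act on $\mathbb{R}^\alpha$ by scalar multiplication, $c\cdot a^\alpha=(ca)^\alpha$. A function $f:I\subseteq\mathbb{R}\to\mathbb{R}^\alpha$ ($I$ an interval) is called a generalized convex function on $I$ if for all $x_1,x_2\in I$ and $\lambda\in[0,1]$, $f(\lambda x_1+(1-\lambda)x_2)\le\lambda^\alpha f(x_1)+(1-\lambda)^\alpha f(x_2)$. The local fractional integral of $f$ of order $\alpha$ over $[a,b]$ is $${}_aI_b^{(\alpha)}f(x)=\frac{1}{\Gamma(1+\alpha)}\int_a^b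 f(t)(dt)^\alpha=\frac{1}{\Gamma(1+\alpha)}\lim_{\Delta t\to0}\sum_{j=0}^{N-1}f(t_j)(\Delta t_j)^\alpha,$$ where $a=t_0<t_1<\dots<t_{N-1}<t_N=b$ is a partition of $[a,b]$, $\Delta t_j=t_{j+1}-t_j$ and $\Delta t=\max_j\Delta t_j$; also ${}_aI_a^{(\alpha)}f(x)=0^\alpha$. The notation $f\in I_x^{(\alpha)}[a,b]$ means that ${}_aI_x^{(\alpha)}f$ exists for every $x\in[a,b]$. *)

theory Defs
  imports "HOL-Analysis.Gamma_Function"
begin

text \<open>The exponent \<open>\<alpha>\<close> is fixed in any discussion of \<open>\<real>\<^sup>\<alpha>\<close>, and neither the field operations nor the
  order depend on it, so one type carries the symbols for every \<open>\<alpha>\<close>: \<open>alpha_pow a\<close> stands for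
  the symbol \<open>a\<^sup>\<alpha>\<close>. (It is a formal symbol, not the real power \<open>a powr \<alpha>\<close>; \<open>a\<close> may be negative.)
  The exponent enters through the absolute value \<open>alpha_norm\<close>, hence through limits, and through
  the Gamma factor of the integral, where it is an explicit argument.\<close>

datatype ralpha = alpha_pow (base: real)

lemma ralpha_eq_iff: "x = y \<longleftrightarrow> base x = base y"
  by (auto intro: ralpha.expand)

instantiation ralpha :: real_field
begin

definition zero_ralpha :: ralpha where "0 = alpha_pow 0"

definition one_ralpha :: ralpha where "1 = alpha_pow 1"

definition plus_ralpha :: "ralpha \<Rightarrow> ralpha \<Rightarrow> ralpha" where
  "x + y = alpha_pow (base x + base y)"

definition uminus_ralpha :: "ralpha \<Rightarrow> ralpha" where
  "- x = alpha_pow (- base x)"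

definition minus_ralpha :: "ralpha \<Rightarrow> ralpha \<Rightarrow> ralpha" where
  "x - y = alpha_pow (base x - base y)"

definition times_ralpha :: "ralpha \<Rightarrow> ralpha \<Rightarrow> ralpha" where
  "x * y = alpha_pow (base x * base y)"

definition inverse_ralpha :: "ralpha \<Rightarrow> ralpha" where
  "inverse x = alpha_pow (inverse (base x))"

definition divide_ralpha :: "ralpha \<Rightarrow> ralpha \<Rightarrow> ralpha" where
  "x div y = alpha_pow (base x / base y)"

definition scaleR_ralpha :: "real \<Rightarrow> ralpha \<Rightarrow> ralpha" where
  "c *\<^sub>R x = alpha_pow (c * base x)"

lemmas ralpha_defs = zero_ralpha_def one_ralpha_def plus_ralpha_def uminus_ralpha_def
  minus_ralpha_def times_ralpha_def inverse_ralpha_def divide_ralpha_def scaleR_ralpha_def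

instance
  by standard (auto simp: ralpha_defs ralpha_eq_iff algebra_simps divide_inverse)

end

instantiation ralpha :: linorder
begin

definition less_eq_ralpha :: "ralpha \<Rightarrow> ralpha \<Rightarrow> bool" where
  "x \<le> y \<longleftrightarrow> base x \<le> base y"

definition less_ralpha :: "ralpha \<Rightarrow> ralpha \<Rightarrow> bool" where
  "x < y \<longleftrightarrow> base x < base y"

instance
  by standard (auto simp: less_eq_ralpha_def less_ralpha_def ralpha_eq_iff)

end

definition alpha_norm :: "real \<Rightarrow> ralpha \<Rightarrow> real" where
  "alpha_norm \<alpha> x = \<bar>base x\<bar> powr \<alpha>"

definition generalized_convex_on :: "real set \<Rightarrow> (real \<Rightarrow> ralpha) \<Rightarrow> bool" where
  "generalized_convex_on I f \<longleftrightarrow>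
    (\<forall>x1\<in>I. \<forall>x2\<in>I. \<forall>l\<in>{0..1}.
      f (l * x1 + (1 - l) * x2) \<le> alpha_pow l * f x1 + alpha_pow (1 - l) * f x2)"

definition is_partition :: "real \<Rightarrow> real \<Rightarrow> nat \<Rightarrow> (nat \<Rightarrow> real) \<Rightarrow> bool" where
  "is_partition a b N t \<longleftrightarrow> t 0 = a \<and> t N = b \<and> (\<forall>j<N. t j < t (Suc j))"

definition mesh :: "nat \<Rightarrow> (nat \<Rightarrow> real) \<Rightarrow> real" where
  "mesh N t = Max ((\<lambda>j. t (Suc j) - t j) ` {..<N})"

definition alpha_sum :: "(real \<Rightarrow> ralpha) \<Rightarrow> nat \<Rightarrow> (nat \<Rightarrow> real) \<Rightarrow> ralpha" where
  "alpha_sum f N t = (\<Sum>j<N. f (t j) * alpha_pow (t (Suc j) - t j))"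

text \<open>\<open>L\<close> is \<open>\<integral>\<^sub>a\<^sup>b f(t) (dt)\<^sup>\<alpha>\<close>, without the Gamma factor; meant for \<open>a < b\<close>.\<close>

definition has_alpha_limit ::
    "real \<Rightarrow> (real \<Rightarrow> ralpha) \<Rightarrow> real \<Rightarrow> real \<Rightarrow> ralpha \<Rightarrow> bool" where
  "has_alpha_limit \<alpha> f a b L \<longleftrightarrow>
    (\<forall>\<epsilon>>0. \<exists>\<delta>>0. \<forall>N t. is_partition a b N t \<longrightarrow> mesh N t < \<delta> \<longrightarrow>
      alpha_norm \<alpha> (alpha_sum f N t - L) < \<epsilon> powr \<alpha>)"

definition has_local_fractional_integral ::
    "real \<Rightarrow> (real \<Rightarrow> ralpha) \<Rightarrow> real \<Rightarrow> real \<Rightarrow> ralpha \<Rightarrow> bool" where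
  "has_local_fractional_integral \<alpha> f a b J \<longleftrightarrow>
    (a = b \<and> J = alpha_pow 0) \<or>
    (a < b \<and> (\<exists>L. has_alpha_limit \<alpha> f a b L \<and> J = (1 / Gamma (1 + \<alpha>)) *\<^sub>R L))"

definition local_fractional_integral ::
    "real \<Rightarrow> (real \<Rightarrow> ralpha) \<Rightarrow> real \<Rightarrow> real \<Rightarrow> ralpha" where
  "local_fractional_integral \<alpha> f a b = (THE J. has_local_fractional_integral \<alpha> f a b J)"

text \<open>\<open>f \<in> I\<^sub>x\<^sup>(\<^sup>\<alpha>\<^sup>)[a, b]\<close>\<close>

definition local_fractional_integrable ::
    "real \<Rightarrow> (real \<Rightarrow> ralpha) \<Rightarrow> real \<Rightarrow> real \<Rightarrow> bool" where
  "local_fractional_integrable \<alpha> f a b \<longleftrightarrow>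
    (\<forall>x\<in>{a..b}. \<exists>J. has_local_fractional_integral \<alpha> f a x J)"

end

theory Submission
  imports Defs
begin

text \<open>Along the uniform partitions of \<open>[a, b]\<close> the integral is the limit of left-endpoint averages of
  the convex real function \<open>g = base \<circ> f\<close>. Bounding \<open>g\<close> at each node by its chord gives the
  right-hand inequality; pairing each node with its mirror image and using midpoint convexity gives
  the left-hand one. The averages agree with those over all \<open>N + 1\<close> nodes up to \<open>O(1/N)\<close>.\<close>

lemma base_simps [simp]:
  "base 0 = 0" "base (x + y) = base x + base y" "base (x - y) = base x - base y"
  "base 1 = 1" "base (x * y) = base x * base y" "base (x / y) = base x / base y"
  "base (c *\<^sub>R x) = c * base x"
  by (simp_all add: ralpha_defs)

lemma base_sum: "base (sum f A) = (\<Sum>x\<in>A. base (f x))"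
  by (induction A rule: infinite_finite_induct) auto

text \<open>For positive exponent, \<open>powr\<close> is strictly increasing on nonnegative reals,
  so limits in \<open>ralpha\<close> are ordinary real limits of the bases, whatever \<alpha> is.
  The base 0 is split off because the cancellation rule for \<open>powr\<close> concerns positive
  arguments.\<close>

lemma alpha_norm_less_iff:
  assumes "0 < \<alpha>" "0 < \<epsilon>"
  shows "alpha_norm \<alpha> x < \<epsilon> powr \<alpha> \<longleftrightarrow> \<bar>base x\<bar> < \<epsilon>"
  using assms powr_less_cancel2[of \<alpha> "\<bar>base x\<bar>" \<epsilon>] powr_less_mono2[of \<alpha> "\<bar>base x\<bar>" \<epsilon>]
  by (cases "base x = 0") (auto simp: alpha_norm_def)

lemma generalized_convex_on_base:
  assumes "generalized_convex_on I f"
    and "x \<in> I" "y \<in> I" "0 \<le> l" "l \<le> 1"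
  shows "base (f (l * x + (1 - l) * y)) \<le> l * base (f x) + (1 - l) * base (f y)"
  using assms by (fastforce simp: generalized_convex_on_def less_eq_ralpha_def)

definition uniform_node :: "real \<Rightarrow> real \<Rightarrow> nat \<Rightarrow> nat \<Rightarrow> real" where
  "uniform_node a b N j = a + real j / real N * (b - a)"

lemma uniform_node_step:
  "uniform_node a b N (Suc j) - uniform_node a b N j = (b - a) / real N"
  by (simp add: uniform_node_def add_divide_distrib ring_distribs diff_divide_distrib)

text \<open>The weight of \<open>b\<close> stays in the form
  \<open>1 - (1 - real j / real N)\<close> so that the right side matches
  \<open>l * x + (1 - l) * y\<close> in \<open>generalized_convex_on_base\<close>.\<close>

lemma uniform_node_convex_combination:
  "uniform_node a b N j = (1 - real j / real N) * a + (1 - (1 - real j / real N)) * b"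
  by (simp add: uniform_node_def right_diff_distrib left_diff_distrib)

lemma uniform_node_0 [simp]: "uniform_node a b N 0 = a"
  by (simp add: uniform_node_def)

lemma uniform_node_last [simp]: "0 < N \<Longrightarrow> uniform_node a b N N = b"
  by (simp add: uniform_node_def)

lemma uniform_node_mem:
  assumes "a \<le> b" "j \<le> N"
  shows "uniform_node a b N j \<in> {a..b}"
proof -
  have "real j / real N \<le> 1"
    \<comment> \<open>For \<open>N = 0\<close> the quotient is 0, by the convention for division by
      zero.\<close>
    using assms(2) by (cases "N = 0") auto
  then have "real j / real N * (b - a) \<le> 1 * (b - a)"
    using assms(1) by (intro mult_right_mono) auto
  then show ?thesis
    using assms(1) by (simp add: uniform_node_def)
qed

lemma is_partition_uniform:
  assumes "a < b" "0 < N"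
  shows "is_partition a b N (uniform_node a b N)"
proof -
  have "uniform_node a b N j < uniform_node a b N (Suc j)" for j
    using uniform_node_step[of a b N j] assms by (smt (verit) divide_pos_pos of_nat_0_less_iff)
  then show ?thesis
    using assms by (simp add: is_partition_def)
qed

lemma mesh_uniform:
  assumes "0 < N"
  shows "mesh N (uniform_node a b N) = (b - a) / real N"
proof -
  have "(\<lambda>j. uniform_node a b N (Suc j) - uniform_node a b N j) ` {..<N} = {(b - a) / real N}"
    using assms by (auto simp: uniform_node_step)
  then show ?thesis
    by (simp add: mesh_def)
qed

text \<open>The node \<open>b\<close> is left out because \<open>alpha_sum\<close> evaluates at left
  endpoints; times \<open>b - a\<close> this is the left Riemann sum.\<close>

definition uniform_average :: "(real \<Rightarrow> ralpha) \<Rightarrow> real \<Rightarrow> real \<Rightarrow> nat \<Rightarrow> real" where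
  "uniform_average f a b N = (\<Sum>j<N. base (f (uniform_node a b N j))) / real N"

lemma alpha_sum_uniform:
  "base (alpha_sum f N (uniform_node a b N)) = (b - a) * uniform_average f a b N"
  by (simp add: alpha_sum_def base_sum uniform_node_step uniform_average_def
      flip: sum_distrib_right sum_divide_distrib)

text \<open>The limit controls all sufficiently fine partitions, in particular the uniform ones,
  whose mesh \<open>(b - a) / real N\<close> tends to 0.\<close>

lemma has_alpha_limit_uniform_average:
  assumes "0 < \<alpha>" "a < b" "has_alpha_limit \<alpha> f a b L"
  shows "uniform_average f a b \<longlonglongrightarrow> base L / (b - a)"
proof -
  have "(\<lambda>N. (b - a) * uniform_average f a b N) \<longlonglongrightarrow> base L"
  proof (rule tendstoI)
    fix e :: real assume "0 < e"
    then obtain d where "0 < d" and d: "\<And>N t. is_partition a b N t \<Longrightarrow> mesh N t < d \<Longrightarrow>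
        alpha_norm \<alpha> (alpha_sum f N t - L) < e powr \<alpha>"
      using assms(3) by (auto simp: has_alpha_limit_def)
    have "(\<lambda>N. (b - a) / real N) \<longlonglongrightarrow> 0"
      by (rule lim_const_over_n)
    then have "\<forall>\<^sub>F N in sequentially. (b - a) / real N < d"
      using \<open>0 < d\<close> by (rule order_tendstoD)
    with eventually_gt_at_top[of 0]
    show "\<forall>\<^sub>F N in sequentially. dist ((b - a) * uniform_average f a b N) (base L) < e"
    proof eventually_elim
      case (elim N)
      then have "alpha_norm \<alpha> (alpha_sum f N (uniform_node a b N) - L) < e powr \<alpha>"
        using assms(2) by (intro d is_partition_uniform) (auto simp: mesh_uniform)
      then show ?case
        using assms(1) \<open>0 < e\<close> by (simp add: alpha_norm_less_iff alpha_sum_uniform dist_real_def)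
    qed
  qed
  then have "(\<lambda>N. (b - a) * uniform_average f a b N / (b - a)) \<longlonglongrightarrow> base L / (b - a)"
    using assms(2) by (intro tendsto_divide) auto
  then show ?thesis
    using assms(2) by simp
qed

text \<open>A single sequence of partitions already determines \<open>L\<close>. This justifies the
  description operator in \<open>local_fractional_integral\<close>.\<close>

lemma has_alpha_limit_unique:
  assumes "0 < \<alpha>" "a < b" "has_alpha_limit \<alpha> f a b L" "has_alpha_limit \<alpha> f a b M"
  shows "L = M"
  using LIMSEQ_unique[OF has_alpha_limit_uniform_average[OF assms(1-3)]
      has_alpha_limit_uniform_average[OF assms(1,2,4)]] assms(2)
  by (simp add: ralpha_eq_iff)

lemma local_fractional_integral_eqI:
  assumes "0 < \<alpha>" "a < b" "has_alpha_limit \<alpha> f a b L"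
  shows "local_fractional_integral \<alpha> f a b = (1 / Gamma (1 + \<alpha>)) *\<^sub>R L"
  unfolding local_fractional_integral_def
  using assms by (intro the_equality)
    (auto simp: has_local_fractional_integral_def dest: has_alpha_limit_unique[OF assms])

text \<open>The mean of \<open>j / N\<close> over \<open>j < N\<close> is
  \<open>1/2 - 1/(2 * N)\<close>, so averaging the chord over left endpoints misses its midpoint
  value by the \<open>1/N\<close> term.\<close>

lemma uniform_average_le:
  assumes "generalized_convex_on {a..b} f" "a \<le> b" "0 < N"
  shows "uniform_average f a b N
    \<le> (base (f a) + base (f b)) / 2 + (base (f a) - base (f b)) / 2 / real N"
proof -
  have gauss: "(\<Sum>j<N. real j) = real N * (real N - 1) / 2"
    by (induction N) (auto simp: field_simps)
  have "(\<Sum>j<N. base (f (uniform_node a b N j)))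
      \<le> (\<Sum>j<N. base (f a) + real j * ((base (f b) - base (f a)) / real N))"
  proof (rule sum_mono)
    fix j assume "j \<in> {..<N}"
    then have "base (f (uniform_node a b N j))
        \<le> (1 - real j / real N) * base (f a) + (1 - (1 - real j / real N)) * base (f b)"
      unfolding uniform_node_convex_combination using assms(2)
      by (intro generalized_convex_on_base[OF assms(1)]) auto
    then show "base (f (uniform_node a b N j))
        \<le> base (f a) + real j * ((base (f b) - base (f a)) / real N)"
      by (simp add: algebra_simps diff_divide_distrib)
  qed
  also have "\<dots> = real N * base (f a) + (real N - 1) / 2 * (base (f b) - base (f a))"
    unfolding sum.distrib sum_distrib_right[symmetric] gauss using assms(3) by simp
  finally show ?thesis
    using assms(3) by (simp add: uniform_average_def field_simps)
qed

text \<open>The reflection \<open>j\<close> to \<open>N - j\<close> permutes the indices up to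
  \<open>N\<close>, but not those below \<open>N\<close>. Hence \<open>N + 1\<close> midpoint values
  are counted first and the term at \<open>b\<close> is removed afterwards, which leaves the
  \<open>1/N\<close> correction.\<close>

lemma uniform_average_ge:
  assumes "generalized_convex_on {a..b} f" "a \<le> b" "0 < N"
  shows "base (f ((a + b) / 2)) + (base (f ((a + b) / 2)) - base (f b)) / real N
    \<le> uniform_average f a b N"
proof -
  let ?g = "\<lambda>j. base (f (uniform_node a b N j))"
  have mirror: "(\<Sum>j\<le>N. ?g j) = (\<Sum>j\<le>N. ?g (N - j))"
    by (rule sum.reindex_bij_witness[of _ "\<lambda>j. N - j" "\<lambda>j. N - j"]) auto
  have "2 * base (f ((a + b) / 2)) \<le> ?g j + ?g (N - j)" if "j \<le> N" for j
  proof -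
    have mid: "(1 / 2) * uniform_node a b N j + (1 - 1 / 2) * uniform_node a b N (N - j) = (a + b) / 2"
      using that assms(3) by (simp add: uniform_node_def of_nat_diff field_simps)
    have "base (f ((a + b) / 2)) \<le> (1 / 2) * ?g j + (1 - 1 / 2) * ?g (N - j)"
      unfolding mid[symmetric] using that assms(2)
      by (intro generalized_convex_on_base[OF assms(1)] uniform_node_mem) auto
    then show ?thesis
      by simp
  qed
  then have "(\<Sum>j\<le>N. 2 * base (f ((a + b) / 2))) \<le> (\<Sum>j\<le>N. ?g j + ?g (N - j))"
    by (intro sum_mono) auto
  also have "\<dots> = 2 * (\<Sum>j\<le>N. ?g j)"
    by (simp add: sum.distrib flip: mirror)
  \<comment> \<open>The last node is \<open>b\<close> since \<open>N\<close> is positive.\<close>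
  also have "(\<Sum>j\<le>N. ?g j) = (\<Sum>j<N. ?g j) + base (f b)"
    using assms(3) by (simp flip: lessThan_Suc_atMost)
  finally have "base (f ((a + b) / 2)) * real N + (base (f ((a + b) / 2)) - base (f b)) \<le> (\<Sum>j<N. ?g j)"
    by (simp add: algebra_simps)
  then have "(base (f ((a + b) / 2)) * real N + (base (f ((a + b) / 2)) - base (f b))) / real N
      \<le> uniform_average f a b N"
    unfolding uniform_average_def by (rule divide_right_mono) simp
  then show ?thesis
    using assms(3) by (simp add: add_divide_distrib)
qed

theorem theorem4p2:
  fixes \<alpha> a b :: real and f :: "real \<Rightarrow> ralpha"
  assumes "0 < \<alpha>" and "\<alpha> \<le> 1"
    and "a < b"
    and "local_fractional_integrable \<alpha> f a b"
    and "generalized_convex_on {a..b} f"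
  shows "f ((a + b) / 2)
           \<le> (Gamma (1 + \<alpha>) *\<^sub>R (1 / alpha_pow (b - a))) * local_fractional_integral \<alpha> f a b
       \<and> (Gamma (1 + \<alpha>) *\<^sub>R (1 / alpha_pow (b - a))) * local_fractional_integral \<alpha> f a b
           \<le> (f a + f b) / alpha_pow 2"
proof -
  \<comment> \<open>Integrability is used at the endpoint \<open>x = b\<close>, where
    \<open>a < b\<close> excludes the degenerate case.\<close>
  obtain L where L: "has_alpha_limit \<alpha> f a b L"
    using assms(3,4)
    by (fastforce simp: local_fractional_integrable_def has_local_fractional_integral_def)
  have average: "uniform_average f a b \<longlonglongrightarrow> base L / (b - a)"
    using has_alpha_limit_uniform_average[OF assms(1,3) L] .
  \<comment> \<open>Both bounds on the averages have this shape, so their corrections vanish in the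
    limit.\<close>
  have affine: "(\<lambda>N. u + v / real N) \<longlonglongrightarrow> u" for u v :: real
    using tendsto_add[OF tendsto_const[of u] lim_const_over_n[of v]] by simp
  have lower: "base (f ((a + b) / 2)) \<le> base L / (b - a)"
    by (rule tendsto_le[OF sequentially_bot average affine],
        rule eventually_mono[OF eventually_gt_at_top[of 0]],
        rule uniform_average_ge[OF assms(5) less_imp_le[OF assms(3)]])
  have upper: "base L / (b - a) \<le> (base (f a) + base (f b)) / 2"
    by (rule tendsto_le[OF sequentially_bot affine average],
        rule eventually_mono[OF eventually_gt_at_top[of 0]],
        rule uniform_average_le[OF assms(5) less_imp_le[OF assms(3)]])
  \<comment> \<open>Being nonzero, this factor cancels the \<open>1 / Gamma (1 + \<alpha>)\<close>
    inside the integral.\<close>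
  have "Gamma (1 + \<alpha>) > 0"
    using assms(1) by (intro Gamma_real_pos) auto
  then have "base ((Gamma (1 + \<alpha>) *\<^sub>R (1 / alpha_pow (b - a))) * local_fractional_integral \<alpha> f a b)
      = base L / (b - a)"
    by (simp add: local_fractional_integral_eqI[OF assms(1,3) L])
  then show ?thesis
    unfolding less_eq_ralpha_def using lower upper by (simp only: base_simps ralpha.sel)
qed

end
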